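(* Up to isomorphism, there are exactly $10$ core graphs on $7$ vertices, namely: $K_7$, $C_7$, $\overline{C_7}$, $C_5+2$, and the graphs $G_1,\dots,G_6$ defined as follows. Each $G_i$ has vertex set $\{a,b,c,d,e,u,v\}$ and contains the $5$-cycle edges $ab,bc,cd,de,ea$, together with the following edges: $G_1$: $ua,ub,uc,va,ve,vd$ (11 edges); $G_2$: $ua,ub,uc,va,ve,vc,vd$ (12 edges); $G_3$: $ua,ub,uc,ud,va,ve,vc,vd$ (13 edges); $G_4$: $ua,ub,uc,va,ve,vd,uv$ (12 edges); $G_5$: $ua,ub,ue,ud,va,ve,vc$ (12 edges); $G_6$: $ua,ub,ue,ud,va,ve,vc,vd$ (13 edges).
   Context: Graphs are finite, simple, undirected, loopless. A graph $H$ is a core if every homomorphism (edge-preserving map) $H\to H$ is bijective. $K_7$ is the complete graph, $C_7$ the $7$-cycle, $\overline{C_7}$ its complement, and $C_5+2$ is obtained from the $5$-cycle $C_5$ by adding two new vertices adjacent to each other and to all vertices of $C_5$. *)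

theory Defs
  imports "Graph_Theory.Pair_Digraph" "Graph_Theory.Digraph_Isomorphism"
begin

text \<open>
  A finite simple graph is a \<^locale>\<open>pair_graph\<close>: each undirected edge $xy$ is represented by
  the two arcs $(x,y)$ and $(y,x)$.
\<close>

definition graph_hom ::
    "'a pair_pre_digraph \<Rightarrow> 'b pair_pre_digraph \<Rightarrow> ('a \<Rightarrow> 'b) \<Rightarrow> bool" where
  "graph_hom G H f \<longleftrightarrow>
     (\<forall>x\<in>pverts G. f x \<in> pverts H) \<and>
     (\<forall>(x, y)\<in>parcs G. (f x, f y) \<in> parcs H)"

definition is_core :: "'a pair_pre_digraph \<Rightarrow> bool" where
  "is_core H \<longleftrightarrow> (\<forall>f. graph_hom H H f \<longrightarrow> bij_betw f (pverts H) (pverts H))"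

text \<open>Each edge is listed in \<open>E\<close> in at least one orientation.\<close>
definition ugraph :: "'a set \<Rightarrow> 'a rel \<Rightarrow> 'a pair_pre_digraph" where
  "ugraph V E = \<lparr>pverts = V, parcs = E \<union> E\<inverse>\<rparr>"

definition complete_graph :: "nat \<Rightarrow> nat pair_pre_digraph" where
  "complete_graph n = ugraph {..<n} {(i, j). i < n \<and> j < n \<and> i \<noteq> j}"

text \<open>Only meaningful for \<open>n \<ge> 3\<close>.\<close>
definition cycle_graph :: "nat \<Rightarrow> nat pair_pre_digraph" where
  "cycle_graph n = ugraph {..<n} {(i, Suc i mod n) | i. i < n}"

definition complement_graph :: "'a pair_pre_digraph \<Rightarrow> 'a pair_pre_digraph" where
  "complement_graph G = \<lparr>pverts = pverts G,
     parcs = {(x, y). x \<in> pverts G \<and> y \<in> pverts G \<and> x \<noteq> y \<and> (x, y) \<notin> parcs G}\<rparr>"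

definition C5_plus_2 :: "nat pair_pre_digraph" where
  "C5_plus_2 = ugraph (pverts (cycle_graph 5) \<union> {5, 6})
     (parcs (cycle_graph 5) \<union> {(5, 6)} \<union> {5, 6} \<times> pverts (cycle_graph 5))"

text \<open>
  In the remaining six graphs the vertices $a,b,c,d,e,u,v$ are encoded as $0,1,2,3,4,5,6$,
  in this order.
\<close>

definition C5_edges :: "nat rel" where
  "C5_edges = {(0, 1), (1, 2), (2, 3), (3, 4), (4, 0)}"

definition core_G1 :: "nat pair_pre_digraph" where
  "core_G1 = ugraph {0, 1, 2, 3, 4, 5, 6} (C5_edges \<union>
     {(5, 0), (5, 1), (5, 2), (6, 0), (6, 4), (6, 3)})"

definition core_G2 :: "nat pair_pre_digraph" where
  "core_G2 = ugraph {0, 1, 2, 3, 4, 5, 6} (C5_edges \<union>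
     {(5, 0), (5, 1), (5, 2), (6, 0), (6, 4), (6, 2), (6, 3)})"

definition core_G3 :: "nat pair_pre_digraph" where
  "core_G3 = ugraph {0, 1, 2, 3, 4, 5, 6} (C5_edges \<union>
     {(5, 0), (5, 1), (5, 2), (5, 3), (6, 0), (6, 4), (6, 2), (6, 3)})"

definition core_G4 :: "nat pair_pre_digraph" where
  "core_G4 = ugraph {0, 1, 2, 3, 4, 5, 6} (C5_edges \<union>
     {(5, 0), (5, 1), (5, 2), (6, 0), (6, 4), (6, 3), (5, 6)})"

definition core_G5 :: "nat pair_pre_digraph" where
  "core_G5 = ugraph {0, 1, 2, 3, 4, 5, 6} (C5_edges \<union>
     {(5, 0), (5, 1), (5, 4), (5, 3), (6, 0), (6, 4), (6, 2)})"

definition core_G6 :: "nat pair_pre_digraph" where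
  "core_G6 = ugraph {0, 1, 2, 3, 4, 5, 6} (C5_edges \<union>
     {(5, 0), (5, 1), (5, 4), (5, 3), (6, 0), (6, 4), (6, 2), (6, 3)})"

lemma parcs_ugraph_insert:
  "parcs (ugraph V {}) = {}"
  "parcs (ugraph V (insert (x, y) E)) = insert (x, y) (insert (y, x) (parcs (ugraph V E)))"
  by (auto simp: ugraph_def)

text \<open>The numbers of edges are $11,12,13,12,12,13$; there are two arcs per edge.\<close>
lemma card_parcs_core_G:
  "card (parcs core_G1) = 2 * 11" "card (parcs core_G2) = 2 * 12"
  "card (parcs core_G3) = 2 * 13" "card (parcs core_G4) = 2 * 12"
  "card (parcs core_G5) = 2 * 12" "card (parcs core_G6) = 2 * 13"
  by (simp_all add: core_G1_def core_G2_def core_G3_def core_G4_def core_G5_def core_G6_def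
      C5_edges_def parcs_ugraph_insert)

end

theory Submission
  imports Defs
begin

text \<open>
  Homomorphically equivalent cores are isomorphic, so it suffices to find homomorphisms in both
  directions. A graph is a core if it is vertex-critical, that is, if it has no homomorphism to
  some $K_k$ but all its vertex-deleted subgraphs have one; apart from $K_7$, whose
  endomorphisms are trivially injective, the listed graphs are vertex-critical. Conversely, let
  $G$ be a core on $7$ vertices that is not complete. In a $P_4$-free graph every maximal stable
  set meets every maximal clique, so such a graph retracts onto a clique; hence $G$ contains an
  induced path $a\,b\,c\,d$. No vertex of a core dominates another one, so there are
  $z \in N(a) \setminus N(c)$ and $w \in N(d) \setminus N(b)$. If $z = w$, these vertices
  induce a $C_5$; otherwise $6$ vertices of $G$ are partially known. In both cases $11$ vertex
  pairs are undecided, and a branching search that cuts off branches with a dominated vertex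
  shows that $G$ is homomorphically equivalent to $K_3$, $K_4$, $C_5$ (impossible for a core on
  $7$ vertices) or to one of the listed graphs.
\<close>

section \<open>Homomorphisms and cores\<close>

lemma graph_hom_comp:
  "graph_hom G H f \<Longrightarrow> graph_hom H K g \<Longrightarrow> graph_hom G K (g \<circ> f)"
  unfolding graph_hom_def by fastforce

lemma pair_graph_sym: "pair_graph G \<Longrightarrow> (x, y) \<in> parcs G \<Longrightarrow> (y, x) \<in> parcs G"
  by (metis pair_graph.axioms(2) pair_pseudo_graph.axioms(2) pair_sym_digraph.pair_sym_arcs
      symmetric_def symD with_proj_simps(3))

lemma pair_graph_irrefl: "pair_graph G \<Longrightarrow> (x, x) \<notin> parcs G"
  using pair_digraph.axioms(2) pair_graph.axioms(1) pair_loopfree_digraph.pair_no_loops by fastforce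

lemma pair_graph_finite: "pair_graph G \<Longrightarrow> finite (pverts G)"
  by (meson pair_digraph.axioms(1) pair_fin_digraph.pair_finite_verts pair_graph.axioms(1))

lemma pair_graph_arcD:
  assumes "pair_graph G" "(x, y) \<in> parcs G"
  shows "x \<in> pverts G" "y \<in> pverts G"
proof -
  interpret pair_graph G by fact
  show "x \<in> pverts G" "y \<in> pverts G" using assms(2) wellformed' by auto
qed

lemma pair_graphI:
  assumes "finite (pverts G)" "parcs G \<subseteq> pverts G \<times> pverts G" "sym (parcs G)"
    "\<And>x. (x, x) \<notin> parcs G"
  shows "pair_graph G"
proof -
  have "finite (parcs G)"
    using assms(1,2) finite_subset by blast
  then show ?thesis
    using assms by unfold_locales (auto simp: symmetric_def)
qed

lemma core_endo_bij: "is_core G \<Longrightarrow> graph_hom G G f \<Longrightarrow> bij_betw f (pverts G) (pverts G)"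
  by (simp add: is_core_def)

text \<open>The composite \<open>g \<circ> f\<close> is an endomorphism of the core, hence
  injective, and therefore so is the map applied first.\<close>

lemma core_hom_inj:
  assumes "is_core G" "graph_hom G H f" "graph_hom H G g"
  shows "inj_on f (pverts G)"
  using core_endo_bij[OF assms(1) graph_hom_comp[OF assms(2,3)]]
  by (auto simp: bij_betw_def dest: inj_on_imageI2)

lemma core_hom_card_le:
  assumes "is_core G" "graph_hom G H f" "graph_hom H G g" "finite (pverts H)"
  shows "card (pverts G) \<le> card (pverts H)"
  using core_hom_inj[OF assms(1-3)] assms(2,4)
  by (intro card_inj_on_le) (auto simp: graph_hom_def)

text \<open>Both maps are injective on vertices and, coordinatewise, on arcs. Comparing
  cardinalities in both directions then makes \<open>f\<close> onto for vertices and for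
  arcs.\<close>

lemma hom_equivalent_cores_iso:
  assumes G: "pair_graph G" "is_core G" and H: "pair_graph H" "is_core H"
    and f: "graph_hom G H f" and g: "graph_hom H G g"
  shows "digraph_iso (with_proj G) (with_proj H)"
proof -
  interpret G: pair_graph G by fact
  interpret H: pair_graph H by fact
  have inj: "inj_on f (pverts G)" and inj': "inj_on g (pverts H)"
    using core_hom_inj assms by blast+
  have "f ` pverts G = pverts H"
    using f card_inj_on_le[OF inj' _ G.pair_finite_verts] g
    by (intro card_seteq H.pair_finite_verts) (auto simp: graph_hom_def card_image[OF inj])
  moreover have inj2: "inj_on (map_prod f f) (parcs G)"
    using inj by (auto simp: inj_on_def) (metis G.wellformed')+
  moreover have inj2': "inj_on (map_prod g g) (parcs H)"
    using inj' by (auto simp: inj_on_def) (metis H.wellformed')+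
  have "map_prod f f ` parcs G = parcs H"
  proof (intro card_seteq H.pair_finite_arcs)
    show "map_prod f f ` parcs G \<subseteq> parcs H"
      using f by (auto simp: graph_hom_def)
    have "map_prod g g ` parcs H \<subseteq> parcs G"
      using g by (auto simp: graph_hom_def)
    then show "card (parcs H) \<le> card (map_prod f f ` parcs G)"
      using card_inj_on_le[OF inj2' _ G.pair_finite_arcs] by (simp add: card_image[OF inj2])
  qed
  ultimately show ?thesis
    unfolding digraph_iso_def
    by (intro exI[of _ "\<lparr>iso_verts = f, iso_arcs = map_prod f f, iso_head = snd, iso_tail = fst\<rparr>"])
      (auto simp: pre_digraph.digraph_isomorphism_def inj inj2 G.wf_digraph_axioms
        app_iso_def intro!: pre_digraph.equality)
qed

lemma digraph_iso_imp_homs: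
  assumes "digraph_iso (with_proj G) (with_proj H)"
  shows "\<exists>f. graph_hom G H f" "\<exists>g. graph_hom H G g" "card (parcs G) = card (parcs H)"
proof -
  obtain h where h: "pre_digraph.digraph_isomorphism (with_proj G) h"
    and H: "with_proj H = app_iso h (with_proj G)"
    using assms by (auto simp: digraph_iso_def)
  define f where "f = iso_verts h"
  have inj: "inj_on f (pverts G)" and wf: "wf_digraph (with_proj G)"
    and arc: "\<And>a. a \<in> parcs G \<Longrightarrow> fst (iso_arcs h a) = f (fst a)"
       "\<And>a. a \<in> parcs G \<Longrightarrow> snd (iso_arcs h a) = f (snd a)"
    and inja: "inj_on (iso_arcs h) (parcs G)"
    and eq: "pverts H = f ` pverts G" "parcs H = iso_arcs h ` parcs G"
    using h H by (auto simp: pre_digraph.digraph_isomorphism_def with_proj_def app_iso_def f_def)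
  \<comment> \<open>A digraph isomorphism may rename arcs, but tail and head are the two projections
    on both sides, so on arcs \<open>iso_arcs h\<close> has to act as
    \<open>map_prod f f\<close>.\<close>
  have "iso_arcs h ` parcs G = map_prod f f ` parcs G"
    using arc by (intro image_cong) (auto simp: prod_eq_iff)
  with eq(2) have parcsH: "parcs H = map_prod f f ` parcs G" by simp
  show "\<exists>f. graph_hom G H f"
    using eq(1) parcsH unfolding graph_hom_def by (intro exI[of _ f]) auto
  have "the_inv_into (pverts G) f (f x) = x" if "x \<in> pverts G" for x
    using inj that by (rule the_inv_into_f_f)
  moreover have "x \<in> pverts G \<and> y \<in> pverts G" if "(x, y) \<in> parcs G" for x y
    using wf_digraph.head_in_verts[OF wf] wf_digraph.tail_in_verts[OF wf] that by fastforce
  ultimately show "\<exists>g. graph_hom H G g"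
    using eq(1) parcsH unfolding graph_hom_def by (intro exI[of _ "the_inv_into (pverts G) f"]) auto
  show "card (parcs G) = card (parcs H)"
    using eq inja by (simp add: card_image)
qed

text \<open>An endomorphism that misses a vertex \<open>v\<close>, followed by a homomorphism to
  \<open>K\<close> defined away from \<open>v\<close>, would be a homomorphism from \<open>G\<close>
  to \<open>K\<close>. So every endomorphism is onto, and by finiteness bijective.\<close>

lemma vertex_critical_is_core:
  assumes "finite (pverts G)" "parcs G \<subseteq> pverts G \<times> pverts G"
    and no_hom: "\<nexists>c. graph_hom G K c"
    and critical: "\<And>v. v \<in> pverts G \<Longrightarrow>
      \<exists>c. (\<forall>x\<in>pverts G - {v}. c x \<in> pverts K) \<and>
        (\<forall>(x, y)\<in>parcs G. x \<noteq> v \<longrightarrow> y \<noteq> v \<longrightarrow> (c x, c y) \<in> parcs K)"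
  shows "is_core G"
  unfolding is_core_def
proof (intro allI impI)
  fix f assume f: "graph_hom G G f"
  have "f ` pverts G = pverts G"
  proof (rule ccontr)
    assume "f ` pverts G \<noteq> pverts G"
    then obtain v where v: "v \<in> pverts G" "v \<notin> f ` pverts G"
      using f by (auto simp: graph_hom_def)
    obtain c where c: "\<forall>x\<in>pverts G - {v}. c x \<in> pverts K"
      "\<forall>(x, y)\<in>parcs G. x \<noteq> v \<longrightarrow> y \<noteq> v \<longrightarrow> (c x, c y) \<in> parcs K"
      using critical[OF v(1)] by blast
    have "graph_hom G K (c \<circ> f)"
      unfolding graph_hom_def
    proof safe
      fix x assume "x \<in> pverts G"
      then show "(c \<circ> f) x \<in> pverts K"
        using f c(1) v(2) by (auto simp: graph_hom_def)
    next
      fix x y assume xy: "(x, y) \<in> parcs G"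
      then have "(f x, f y) \<in> parcs G" "f x \<noteq> v" "f y \<noteq> v"
        using f v(2) assms(2) by (auto simp: graph_hom_def)
      then show "((c \<circ> f) x, (c \<circ> f) y) \<in> parcs K"
        using c(2) by auto
    qed
    with no_hom show False by blast
  qed
  with assms(1) show "bij_betw f (pverts G) (pverts G)"
    by (simp add: bij_betw_def eq_card_imp_inj_on)
qed

lemma is_core_complete:
  assumes "pair_graph G" and "\<And>x y. x \<in> pverts G \<Longrightarrow> y \<in> pverts G \<Longrightarrow> x \<noteq> y \<Longrightarrow> (x, y) \<in> parcs G"
  shows "is_core G"
  unfolding is_core_def
proof (intro allI impI)
  fix f assume f: "graph_hom G G f"
  have "inj_on f (pverts G)"
  proof (rule inj_onI, rule ccontr)
    fix x y assume *: "x \<in> pverts G" "y \<in> pverts G" "f x = f y" "x \<noteq> y"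
    then have "(f x, f y) \<in> parcs G"
      using assms(2) f unfolding graph_hom_def by blast
    with * pair_graph_irrefl[OF assms(1)] show False by simp
  qed
  then show "bij_betw f (pverts G) (pverts G)"
    using f pair_graph_finite[OF assms(1)]
    by (simp add: bij_betw_def graph_hom_def endo_inj_surj image_subset_iff)
qed

text \<open>Otherwise folding \<open>x\<close> onto \<open>y\<close> and fixing all other vertices
  would be a non-injective endomorphism.\<close>

lemma core_not_dominated:
  assumes G: "pair_graph G" "is_core G" and xy: "x \<in> pverts G" "y \<in> pverts G" "x \<noteq> y"
  shows "\<exists>z. (x, z) \<in> parcs G \<and> (y, z) \<notin> parcs G"
proof (rule ccontr)
  assume "\<not> ?thesis"
  then have dom: "(x, z) \<in> parcs G \<Longrightarrow> (y, z) \<in> parcs G" for z by blast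
  have "graph_hom G G (id(x := y))"
    unfolding graph_hom_def
  proof safe
    fix a b assume ab: "(a, b) \<in> parcs G"
    then have "(b, a) \<in> parcs G" "a \<noteq> b"
      using pair_graph_sym[OF G(1)] pair_graph_irrefl[OF G(1)] by auto
    with ab show "((id(x := y)) a, (id(x := y)) b) \<in> parcs G"
      using dom[of b] pair_graph_sym[OF G(1) dom[of a]] by auto
  qed (use xy in auto)
  then have "inj_on (id(x := y)) (pverts G)"
    using core_endo_bij[OF G(2)] by (auto simp: bij_betw_def)
  with xy show False by (auto simp: inj_on_def)
qed

section \<open>Graphs without induced paths on four vertices\<close>

text \<open>Serves both stable sets and cliques. Maximality is tested by adding a single vertex,
  which yields the neighbour or non-neighbour needed below.\<close>

lemma ex_maximal_superset:
  assumes "finite V" "X \<subseteq> V" "Q X"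
  shows "\<exists>Y. X \<subseteq> Y \<and> Y \<subseteq> V \<and> Q Y \<and> (\<forall>v\<in>V. Q (insert v Y) \<longrightarrow> v \<in> Y)"
proof -
  have "finite {Y. Y \<subseteq> V \<and> Q Y}" using assms(1) by auto
  from finite_has_maximal2[OF this, of X] assms obtain Y where
    "X \<subseteq> Y" "Y \<subseteq> V" "Q Y" "\<forall>Z\<in>{Y. Y \<subseteq> V \<and> Q Y}. Y \<subseteq> Z \<longrightarrow> Y = Z"
    by auto
  then show ?thesis by (intro exI[of _ Y]) blast
qed

text \<open>If the sets were disjoint, take \<open>s\<close> in \<open>S\<close> with the most
  neighbours in \<open>K\<close>, a non-neighbour \<open>k\<close> of \<open>s\<close> in
  \<open>K\<close>, and a neighbour \<open>s'\<close> of \<open>k\<close> in \<open>S\<close>. Some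
  \<open>k'\<close> in \<open>K\<close> is adjacent to \<open>s\<close> but not to
  \<open>s'\<close>, and then \<open>s\<close>, \<open>k'\<close>, \<open>k\<close>,
  \<open>s'\<close> is an induced path.\<close>

lemma P4_free_maximal_clique_meets_stable:
  assumes fin: "finite K" and sym: "\<And>x y. E x y \<Longrightarrow> E y x"
    and S: "S \<noteq> {}" "\<And>x y. x \<in> S \<Longrightarrow> y \<in> S \<Longrightarrow> \<not> E x y"
    and S_max: "\<And>k. k \<in> K \<Longrightarrow> k \<notin> S \<Longrightarrow> \<exists>s\<in>S. E k s"
    and K: "\<And>x y. x \<in> K \<Longrightarrow> y \<in> K \<Longrightarrow> x \<noteq> y \<Longrightarrow> E x y"
    and K_max: "\<And>s. s \<in> S \<Longrightarrow> s \<notin> K \<Longrightarrow> \<exists>k\<in>K. \<not> E s k"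
    and P4_free: "\<And>a b c d. a \<in> S \<union> K \<Longrightarrow> b \<in> S \<union> K \<Longrightarrow> c \<in> S \<union> K \<Longrightarrow> d \<in> S \<union> K \<Longrightarrow>
      E a b \<Longrightarrow> E b c \<Longrightarrow> E c d \<Longrightarrow> E a c \<or> E b d \<or> E a d"
  shows "K \<inter> S \<noteq> {}"
proof
  assume disj: "K \<inter> S = {}"
  let ?d = "\<lambda>s. card {k \<in> K. E s k}"
  have bounded: "\<forall>s. s \<in> S \<longrightarrow> ?d s < Suc (card K)"
    by (auto simp: less_Suc_eq_le intro!: card_mono fin)
  obtain s\<^sub>0 where "s\<^sub>0 \<in> S" using S(1) by blast
  from ex_has_greatest_nat[of "\<lambda>s. s \<in> S", OF this bounded]
  obtain s where s: "s \<in> S" and s_max: "\<forall>s'. s' \<in> S \<longrightarrow> ?d s' \<le> ?d s"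
    by blast
  obtain k where k: "k \<in> K" "\<not> E s k"
    using K_max s disj by blast
  obtain s' where s': "s' \<in> S" "E k s'"
    using S_max k(1) disj by blast
  \<comment> \<open>Since \<open>k\<close> is adjacent to \<open>s'\<close> and not to
    \<open>s\<close>, an inclusion of these neighbourhoods would be strict and contradict the choice
    of \<open>s\<close>.\<close>
  have "\<not> {k \<in> K. E s k} \<subset> {k \<in> K. E s' k}"
    using psubset_card_mono[of "{k \<in> K. E s' k}" "{k \<in> K. E s k}"] s_max s'(1) fin
    by (auto simp: not_less[symmetric])
  then obtain k' where k': "k' \<in> K" "E s k'" "\<not> E s' k'"
    using k s' sym by blast
  have "E k' k" using K k k' by metis
  then show False
    using P4_free[of s k' k s'] s k k' s' S(2) sym by blast
qed

text \<open>Split off a maximal stable set \<open>S\<close>, map the rest to a clique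
  \<open>K'\<close> by induction, and extend \<open>K'\<close> to a maximal clique \<open>K\<close>
  of \<open>V\<close>. It meets \<open>S\<close> in some \<open>s\<close>, and sending all of
  \<open>S\<close> to \<open>s\<close> extends the map.\<close>

lemma P4_free_retracts_to_clique:
  assumes "finite V" and sym: "\<And>x y. E x y \<Longrightarrow> E y x" and irrefl: "\<And>x. \<not> E x x"
    and P4_free: "\<And>a b c d. a \<in> V \<Longrightarrow> b \<in> V \<Longrightarrow> c \<in> V \<Longrightarrow> d \<in> V \<Longrightarrow>
      E a b \<Longrightarrow> E b c \<Longrightarrow> E c d \<Longrightarrow> E a c \<or> E b d \<or> E a d"
  shows "\<exists>K f. K \<subseteq> V \<and> (\<forall>x\<in>K. \<forall>y\<in>K. x \<noteq> y \<longrightarrow> E x y) \<and> f ` V \<subseteq> K \<and>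
    (\<forall>x\<in>V. \<forall>y\<in>V. E x y \<longrightarrow> E (f x) (f y))"
  using assms(1) P4_free
proof (induction V rule: finite_psubset_induct)
  case (psubset V)
  show ?case
  proof (cases "V = {}")
    case False
    then obtain v where v: "v \<in> V" by blast
    have "{v} \<subseteq> V" "\<forall>x\<in>{v}. \<forall>y\<in>{v}. \<not> E x y"
      using v irrefl by auto
    from ex_maximal_superset[where Q = "\<lambda>S. \<forall>x\<in>S. \<forall>y\<in>S. \<not> E x y", OF psubset.hyps this]
    obtain S where S: "{v} \<subseteq> S" "S \<subseteq> V" "\<forall>x\<in>S. \<forall>y\<in>S. \<not> E x y"
      and S_max: "\<forall>x\<in>V. (\<forall>y\<in>insert x S. \<forall>z\<in>insert x S. \<not> E y z) \<longrightarrow> x \<in> S"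
      by (elim exE conjE)
    have "V - S \<subset> V" using S v by blast
    then have "\<exists>K f. K \<subseteq> V - S \<and> (\<forall>x\<in>K. \<forall>y\<in>K. x \<noteq> y \<longrightarrow> E x y) \<and> f ` (V - S) \<subseteq> K \<and>
        (\<forall>x\<in>V - S. \<forall>y\<in>V - S. E x y \<longrightarrow> E (f x) (f y))"
      by (rule psubset.IH) (rule psubset.prems; blast)
    then obtain K' f where K': "K' \<subseteq> V - S" "\<forall>x\<in>K'. \<forall>y\<in>K'. x \<noteq> y \<longrightarrow> E x y"
      and f: "f ` (V - S) \<subseteq> K'" "\<forall>x\<in>V - S. \<forall>y\<in>V - S. E x y \<longrightarrow> E (f x) (f y)"
      by (elim exE conjE)
    have "K' \<subseteq> V" using K'(1) by blast
    from ex_maximal_superset[where Q = "\<lambda>K. \<forall>x\<in>K. \<forall>y\<in>K. x \<noteq> y \<longrightarrow> E x y",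
        OF psubset.hyps this K'(2)]
    obtain K where K: "K' \<subseteq> K" "K \<subseteq> V" "\<forall>x\<in>K. \<forall>y\<in>K. x \<noteq> y \<longrightarrow> E x y"
      and K_max: "\<forall>x\<in>V. (\<forall>y\<in>insert x K. \<forall>z\<in>insert x K. y \<noteq> z \<longrightarrow> E y z) \<longrightarrow> x \<in> K"
      by (elim exE conjE)
    have "K \<inter> S \<noteq> {}"
    proof (rule P4_free_maximal_clique_meets_stable[where E = E])
      show "finite K" using K(2) psubset.hyps finite_subset by blast
      show "\<exists>s\<in>S. E k s" if "k \<in> K" "k \<notin> S" for k
        using bspec[OF S_max, of k] that K(2) S(3) irrefl sym by blast
      show "\<exists>k\<in>K. \<not> E s k" if "s \<in> S" "s \<notin> K" for s
        using bspec[OF K_max, of s] that K(3) S(2) sym by blast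
      show "E a c \<or> E b d \<or> E a d" if "a \<in> S \<union> K" "b \<in> S \<union> K" "c \<in> S \<union> K" "d \<in> S \<union> K"
        "E a b" "E b c" "E c d" for a b c d
        using psubset.prems[of a b c d] that S(2) K(2) by blast
    qed (use S K sym irrefl in auto)
    then obtain s where s: "s \<in> K" "s \<in> S" by blast
    let ?f = "\<lambda>x. if x \<in> S then s else f x"
    have adj: "E s (f x)" if "x \<in> V - S" for x
    proof -
      have "f x \<in> K'" using f(1) that by blast
      then have "f x \<in> K" "s \<noteq> f x" using K(1) K'(1) s by auto
      then show ?thesis using K(3) s by blast
    qed
    have "insert s K' \<subseteq> V" "\<forall>x\<in>insert s K'. \<forall>y\<in>insert s K'. x \<noteq> y \<longrightarrow> E x y"
      using K K' s by blast+
    moreover have "?f ` V \<subseteq> insert s K'"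
      using f by auto
    moreover have "\<forall>x\<in>V. \<forall>y\<in>V. E x y \<longrightarrow> E (?f x) (?f y)"
      using f(2) adj S(3) sym by auto
    ultimately show ?thesis by blast
  qed simp
qed

text \<open>Without such a path there is an endomorphism whose image lies in a clique. Endomorphisms
  of a core are onto, so the graph would be complete.\<close>

lemma core_induced_P4:
  assumes G: "pair_graph G" "is_core G"
    and not_complete: "\<exists>x\<in>pverts G. \<exists>y\<in>pverts G. x \<noteq> y \<and> (x, y) \<notin> parcs G"
  shows "\<exists>a b c d. (a, b) \<in> parcs G \<and> (b, c) \<in> parcs G \<and> (c, d) \<in> parcs G \<and>
    (a, c) \<notin> parcs G \<and> (b, d) \<notin> parcs G \<and> (a, d) \<notin> parcs G"
proof (rule ccontr)
  assume contra: "\<not> ?thesis"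
  have "\<exists>K f. K \<subseteq> pverts G \<and> (\<forall>x\<in>K. \<forall>y\<in>K. x \<noteq> y \<longrightarrow> (x, y) \<in> parcs G) \<and>
    f ` pverts G \<subseteq> K \<and> (\<forall>x\<in>pverts G. \<forall>y\<in>pverts G. (x, y) \<in> parcs G \<longrightarrow> (f x, f y) \<in> parcs G)"
    using contra by (intro P4_free_retracts_to_clique)
      (auto intro: pair_graph_sym[OF G(1)] simp: pair_graph_finite[OF G(1)] pair_graph_irrefl[OF G(1)])
  then obtain K f where K: "K \<subseteq> pverts G" "\<forall>x\<in>K. \<forall>y\<in>K. x \<noteq> y \<longrightarrow> (x, y) \<in> parcs G"
    and f: "f ` pverts G \<subseteq> K"
      "\<forall>x\<in>pverts G. \<forall>y\<in>pverts G. (x, y) \<in> parcs G \<longrightarrow> (f x, f y) \<in> parcs G"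
    by (elim exE conjE)
  have "graph_hom G G f"
    using K(1) f pair_graph_arcD[OF G(1)] unfolding graph_hom_def by auto
  then have "f ` pverts G = pverts G"
    using core_endo_bij[OF G(2)] by (auto simp: bij_betw_def)
  with K f(1) not_complete show False by auto
qed

section \<open>Searching for homomorphisms\<close>

text \<open>Vertices survive only as list positions, so the searches evaluate on Boolean lists
  whatever the vertex type is.\<close>

definition matrix :: "('a \<Rightarrow> 'a \<Rightarrow> bool) \<Rightarrow> 'a list \<Rightarrow> bool list list" where
  "matrix A vs = map (\<lambda>x. map (A x) vs) vs"

text \<open>
  Backtracking with forward checking: the vertices of the source are assigned in order, and the
  rows of \<open>ds\<close> mark the images in \<open>T\<close> that are still admissible for the remaining vertices.
\<close>
fun hom_search :: "bool list list \<Rightarrow> bool list list \<Rightarrow> bool list list \<Rightarrow> bool" where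
  "hom_search T [] ds = True"
| "hom_search T (r # rs) ds = list_ex (\<lambda>(b, t). b \<and>
     hom_search T (map tl rs) (map2 (\<lambda>e d. if e then map2 (\<and>) d t else d) (tl r) (tl ds)))
     (zip (hd ds) T)"

text \<open>The domains \<open>D\<close> are arbitrary so that in the induction they absorb the
  constraints imposed by vertices already assigned. Only pairs in list order are
  constrained.\<close>

lemma hom_search_matrix:
  assumes "distinct vs"
  shows "hom_search (matrix B ws) (matrix A vs) (map (\<lambda>x. map (D x) ws) vs) \<longleftrightarrow>
    (\<exists>f. (\<forall>x\<in>set vs. f x \<in> set ws \<and> D x (f x)) \<and>
      sorted_wrt (\<lambda>x y. A x y \<longrightarrow> B (f x) (f y)) vs)"
  using assms
proof (induction vs arbitrary: D)
  case Nil
  then show ?case by (simp add: matrix_def)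
next
  case (Cons x xs)
  have cons: "matrix A (x # xs) = (A x x # map (A x) xs) # map (\<lambda>y. A y x # map (A y) xs) xs"
    by (simp add: matrix_def)
  have zip: "zip (map (D x) ws) (matrix B ws) = map (\<lambda>w. (D x w, map (B w) ws)) ws"
    by (simp add: matrix_def zip_map_map zip_same_conv_map)
  have tl: "map tl (map (\<lambda>y. A y x # map (A y) xs) xs) = matrix A xs"
    by (simp add: matrix_def)
  have restrict: "map2 (\<lambda>e d. if e then map2 (\<and>) d (map (B w) ws) else d)
      (map (A x) xs) (map (\<lambda>y. map (D y) ws) xs) =
      map (\<lambda>y. map (\<lambda>w'. D y w' \<and> (A x y \<longrightarrow> B w w')) ws) xs" for w
    by (auto simp: map2_map_map)
  have "hom_search (matrix B ws) (matrix A (x # xs)) (map (\<lambda>x. map (D x) ws) (x # xs)) \<longleftrightarrow>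
    (\<exists>w\<in>set ws. D x w \<and> hom_search (matrix B ws) (matrix A xs)
      (map (\<lambda>y. map (\<lambda>w'. D y w' \<and> (A x y \<longrightarrow> B w w')) ws) xs))"
    by (simp add: cons zip tl restrict list_ex_iff Bex_def del: map_map)
  also have "\<dots> \<longleftrightarrow> (\<exists>w\<in>set ws. D x w \<and> (\<exists>f.
      (\<forall>y\<in>set xs. f y \<in> set ws \<and> D y (f y) \<and> (A x y \<longrightarrow> B w (f y))) \<and>
      sorted_wrt (\<lambda>x y. A x y \<longrightarrow> B (f x) (f y)) xs))"
    using Cons by simp
  also have "\<dots> \<longleftrightarrow> (\<exists>f. (\<forall>y\<in>set (x # xs). f y \<in> set ws \<and> D y (f y)) \<and>
      sorted_wrt (\<lambda>x y. A x y \<longrightarrow> B (f x) (f y)) (x # xs))" (is "?L \<longleftrightarrow> ?R")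
  proof
    assume ?L
    then obtain w f where w: "w \<in> set ws" "D x w"
      and f: "\<forall>y\<in>set xs. f y \<in> set ws \<and> D y (f y) \<and> (A x y \<longrightarrow> B w (f y))"
        "sorted_wrt (\<lambda>x y. A x y \<longrightarrow> B (f x) (f y)) xs"
      by blast
    \<comment> \<open>Because the list is distinct, redefining \<open>f\<close> at \<open>x\<close>
      does not disturb the values on \<open>xs\<close>.\<close>
    have neq: "y \<noteq> x" if "y \<in> set xs" for y using Cons.prems that by auto
    have "sorted_wrt (\<lambda>y z. A y z \<longrightarrow> B ((f(x := w)) y) ((f(x := w)) z)) xs"
      by (rule sorted_wrt_mono_rel[OF _ f(2)]) (auto dest: neq)
    with w f neq show ?R by (intro exI[of _ "f(x := w)"]) auto
  qed auto
  finally show ?case .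
qed

definition hom_exists :: "bool list list \<Rightarrow> bool list list \<Rightarrow> bool" where
  "hom_exists S T = hom_search T S (map (\<lambda>_. map (\<lambda>_. True) T) S)"

definition row_degree :: "bool list \<Rightarrow> nat" where
  "row_degree r = length (filter id r)"

text \<open>Restricting the search to degree-preserving maps finds isomorphisms quickly.\<close>
definition degree_hom_exists :: "bool list list \<Rightarrow> bool list list \<Rightarrow> bool" where
  "degree_hom_exists S T =
     hom_search T S (map (\<lambda>d. map ((=) d) (map row_degree T)) (map row_degree S))"

lemma hom_exists_matrix:
  assumes "distinct vs"
  shows "hom_exists (matrix A vs) (matrix B ws) \<longleftrightarrow>
    (\<exists>f. (\<forall>x\<in>set vs. f x \<in> set ws) \<and> sorted_wrt (\<lambda>x y. A x y \<longrightarrow> B (f x) (f y)) vs)"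
  using hom_search_matrix[OF assms, of B ws A "\<lambda>_ _. True"]
  by (simp add: hom_exists_def matrix_def comp_def)

text \<open>Smaller initial domains can only remove solutions.\<close>

lemma degree_hom_exists_imp:
  assumes "distinct vs" "degree_hom_exists (matrix A vs) (matrix B ws)"
  shows "hom_exists (matrix A vs) (matrix B ws)"
  using assms(2) hom_search_matrix[OF assms(1), of B ws A
      "\<lambda>x w. row_degree (map (A x) vs) = row_degree (map (B w) ws)"]
  unfolding hom_exists_matrix[OF assms(1)]
  by (auto simp: degree_hom_exists_def matrix_def comp_def)

text \<open>Meant for graphs whose vertex set is an initial segment of the naturals.\<close>

definition adj_matrix :: "nat pair_pre_digraph \<Rightarrow> bool list list" where
  "adj_matrix G = matrix (\<lambda>i j. (i, j) \<in> parcs G) [0..<card (pverts G)]"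

text \<open>The source matrix may have too many edges and the target matrix too few, so one computed
  search covers every pair of graphs within these bounds.\<close>

lemma hom_exists_imp_graph_hom:
  assumes G: "pair_graph G" "pverts G = set vs" "distinct vs"
    and H: "pair_graph H" "pverts H = set ws"
    and q: "\<And>x y. x \<in> set vs \<Longrightarrow> y \<in> set vs \<Longrightarrow> (x, y) \<in> parcs G \<Longrightarrow> q x y"
    and p: "\<And>x y. x \<in> set ws \<Longrightarrow> y \<in> set ws \<Longrightarrow> p x y \<Longrightarrow> (x, y) \<in> parcs H"
    and hom: "hom_exists (matrix q vs) (matrix p ws)"
  shows "\<exists>f. graph_hom G H f"
proof -
  obtain f where f: "\<forall>x\<in>set vs. f x \<in> set ws" "sorted_wrt (\<lambda>x y. q x y \<longrightarrow> p (f x) (f y)) vs"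
    using hom hom_exists_matrix[OF G(3)] by blast
  have "(f x, f y) \<in> parcs H" if xy: "(x, y) \<in> parcs G" for x y
  proof -
    obtain i j where ij: "i < length vs" "j < length vs" "x = vs ! i" "y = vs ! j"
      using pair_graph_arcD[OF G(1) xy] G(2) by (auto simp: in_set_conv_nth)
    have step: "(f (vs ! i), f (vs ! j)) \<in> parcs H"
      if "i < j" "j < length vs" "(vs ! i, vs ! j) \<in> parcs G" for i j
      using that f q p sorted_wrt_iff_nth_less[of "\<lambda>x y. q x y \<longrightarrow> p (f x) (f y)" vs] by simp
    have "i \<noteq> j" using xy ij pair_graph_irrefl[OF G(1)] by auto
    \<comment> \<open>The search constrains pairs in list order only; the other order follows by
      symmetry of \<open>G\<close> and \<open>H\<close>.\<close>
    then consider "i < j" | "j < i" by linarith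
    then show ?thesis
    proof cases
      case 1
      then show ?thesis using step[of i j] ij xy by simp
    next
      case 2
      then have "(f y, f x) \<in> parcs H"
        using step[of j i] ij pair_graph_sym[OF G(1) xy] by simp
      then show ?thesis by (rule pair_graph_sym[OF H(1)])
    qed
  qed
  then show ?thesis
    using f(1) G(2) H(2) unfolding graph_hom_def by auto
qed

lemma graph_hom_imp_hom_exists:
  assumes "graph_hom G H f" "pverts G = set vs" "distinct vs" "pverts H = set ws"
  shows "hom_exists (matrix (\<lambda>x y. (x, y) \<in> parcs G) vs) (matrix (\<lambda>x y. (x, y) \<in> parcs H) ws)"
  unfolding hom_exists_matrix[OF assms(3)] sorted_wrt_iff_nth_less
  using assms by (intro exI[of _ f]) (auto simp: graph_hom_def)

section \<open>Searching for cores\<close>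

text \<open>
  The unknown graph is sandwiched between two matrices: \<open>P\<close> contains the edges known to be
  present and \<open>Q\<close> those not known to be absent. If the row of a vertex in \<open>Q\<close> lies below the
  row of another one in \<open>P\<close>, then the former is dominated in every graph between \<open>P\<close> and \<open>Q\<close>.
\<close>
fun dominated :: "(bool list \<times> bool list) list \<Rightarrow> bool" where
  "dominated [] = False"
| "dominated ((p, q) # rs) =
     (list_ex (\<lambda>(p', q'). list_all2 (\<longrightarrow>) q p' \<or> list_all2 (\<longrightarrow>) q' p) rs \<or> dominated rs)"

text \<open>The list \<open>us\<close> of rows shrinks in the recursion while the columns
  \<open>vs\<close> stay complete, hence two separate lists.\<close>

lemma dominated_imp:
  assumes "dominated (map (\<lambda>x. (map (p x) vs, map (q x) vs)) us)" "distinct us"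
  shows "\<exists>x\<in>set us. \<exists>y\<in>set us. x \<noteq> y \<and> (\<forall>z\<in>set vs. q x z \<longrightarrow> p y z)"
  using assms
proof (induction us)
  case (Cons u us)
  then consider "dominated (map (\<lambda>x. (map (p x) vs, map (q x) vs)) us)"
    | y where "y \<in> set us" "(\<forall>z\<in>set vs. q u z \<longrightarrow> p y z) \<or> (\<forall>z\<in>set vs. q y z \<longrightarrow> p u z)"
    by (auto simp: list_ex_iff list_all2_map1 list_all2_map2 list_all2_same)
  then show ?case
  proof cases
    case 1
    then show ?thesis using Cons by auto
  next
    case 2
    then have "u \<noteq> y" using Cons.prems by auto
    with 2 show ?thesis by (metis list.set_intros)
  qed
qed simp

definition set_entry :: "nat \<Rightarrow> nat \<Rightarrow> bool \<Rightarrow> bool list list \<Rightarrow> bool list list" where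
  "set_entry i j b M = M[i := (M ! i)[j := b], j := (M ! j)[i := b]]"

lemma set_entry_matrix:
  assumes "i < n" "j < n" "i \<noteq> j"
  shows "set_entry i j b (matrix p [0..<n]) =
    matrix (\<lambda>x y. if (x, y) = (i, j) \<or> (x, y) = (j, i) then b else p x y) [0..<n]"
  using assms
  by (intro nth_equalityI) (auto simp: set_entry_def matrix_def nth_list_update intro!: nth_equalityI)

text \<open>The comparison of degree sums only serves to reject most candidates early.\<close>
definition resolved ::
  "bool list list list \<Rightarrow> bool list list list \<Rightarrow> bool list list \<Rightarrow> bool list list \<Rightarrow> bool" where
  "resolved Ts Hs P Q \<longleftrightarrow>
     list_ex (\<lambda>T. hom_exists Q T \<and> hom_exists T P) Ts \<or>
     list_ex (\<lambda>H. sum_list (map row_degree H) = sum_list (map row_degree P) \<and>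
       degree_hom_exists Q H \<and> degree_hom_exists H P) Hs"

text \<open>The list of pairs holds those still to be branched on: the first branch records an edge
  in \<open>P\<close>, the second deletes it from \<open>Q\<close>.\<close>

fun sandwich_search :: "bool list list list \<Rightarrow> bool list list list \<Rightarrow> (nat \<times> nat) list \<Rightarrow>
    bool list list \<Rightarrow> bool list list \<Rightarrow> bool" where
  "sandwich_search Ts Hs [] P Q \<longleftrightarrow> dominated (zip P Q) \<or> resolved Ts Hs P Q"
| "sandwich_search Ts Hs ((i, j) # us) P Q \<longleftrightarrow> dominated (zip P Q) \<or>
     sandwich_search Ts Hs us (set_entry i j True P) Q \<and>
     sandwich_search Ts Hs us P (set_entry i j False Q)"

text \<open>\<open>G\<close> is contained in \<open>q\<close>, which maps to \<open>T\<close>, and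
  \<open>T\<close> maps to \<open>p\<close>, which is contained in \<open>G\<close>.\<close>

lemma resolved_imp_hom_equivalent:
  assumes G: "pair_graph G" "pverts G = {..<n}"
    and p: "\<And>x y. x < n \<Longrightarrow> y < n \<Longrightarrow> p x y \<Longrightarrow> (x, y) \<in> parcs G"
    and q: "\<And>x y. x < n \<Longrightarrow> y < n \<Longrightarrow> (x, y) \<in> parcs G \<Longrightarrow> q x y"
    and targets: "\<And>T. T \<in> set (Ts @ Hs) \<Longrightarrow> pair_graph T \<and> pverts T = {..<card (pverts T)}"
    and resolved: "resolved (map adj_matrix Ts) (map adj_matrix Hs)
      (matrix p [0..<n]) (matrix q [0..<n])"
  shows "\<exists>T\<in>set (Ts @ Hs). (\<exists>f. graph_hom G T f) \<and> (\<exists>g. graph_hom T G g)"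
proof -
  have deg: "hom_exists (matrix q [0..<n]) (adj_matrix T) \<and> hom_exists (adj_matrix T) (matrix p [0..<n])"
    if "degree_hom_exists (matrix q [0..<n]) (adj_matrix T)"
      "degree_hom_exists (adj_matrix T) (matrix p [0..<n])" for T
    using that by (simp add: adj_matrix_def degree_hom_exists_imp)
  have "\<exists>T\<in>set (Ts @ Hs). hom_exists (matrix q [0..<n]) (adj_matrix T) \<and>
      hom_exists (adj_matrix T) (matrix p [0..<n])"
    using resolved deg by (auto simp: resolved_def list_ex_iff)
  then obtain T where T: "T \<in> set (Ts @ Hs)"
    and homs: "hom_exists (matrix q [0..<n]) (adj_matrix T)"
      "hom_exists (adj_matrix T) (matrix p [0..<n])"
    by blast
  have "pair_graph T" "pverts T = set [0..<card (pverts T)]" "pverts G = set [0..<n]"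
    using targets[OF T] G by (auto simp: atLeast0LessThan)
  note ctxt = this
  have "\<exists>f. graph_hom G T f"
    by (rule hom_exists_imp_graph_hom[OF G(1) ctxt(3) _ ctxt(1,2) _ _ homs(1)[unfolded adj_matrix_def]])
      (use q in auto)
  moreover have "\<exists>g. graph_hom T G g"
    by (rule hom_exists_imp_graph_hom[OF ctxt(1,2) _ G(1) ctxt(3) _ _ homs(2)[unfolded adj_matrix_def]])
      (use p in auto)
  ultimately show ?thesis using T by blast
qed

text \<open>A domination between the matrices would give one in \<open>G\<close>: the neighbours of
  \<open>x\<close> lie in its row of \<open>q\<close>, thus in the row of \<open>y\<close> in
  \<open>p\<close>, thus among the neighbours of \<open>y\<close>.\<close>

lemma sandwich_not_dominated:
  assumes G: "pair_graph G" "is_core G" "pverts G = {..<n}"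
    and p: "\<And>x y. x < n \<Longrightarrow> y < n \<Longrightarrow> p x y \<Longrightarrow> (x, y) \<in> parcs G"
    and q: "\<And>x y. x < n \<Longrightarrow> y < n \<Longrightarrow> (x, y) \<in> parcs G \<Longrightarrow> q x y"
  shows "\<not> dominated (zip (matrix p [0..<n]) (matrix q [0..<n]))"
proof
  assume "dominated (zip (matrix p [0..<n]) (matrix q [0..<n]))"
  then have "dominated (map (\<lambda>x. (map (p x) [0..<n], map (q x) [0..<n])) [0..<n])"
    by (simp add: matrix_def zip_map_map zip_same_conv_map comp_def)
  from dominated_imp[OF this] obtain x y where xy: "x < n" "y < n" "x \<noteq> y"
    and dom: "\<And>z. z < n \<Longrightarrow> q x z \<Longrightarrow> p y z"
    by auto
  obtain z where "(x, z) \<in> parcs G" "(y, z) \<notin> parcs G"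
    using core_not_dominated[OF G(1,2), of x y] xy G(3) by auto
  with xy dom[of z] p[of y z] q[of x z] show False
    using pair_graph_arcD[OF G(1)] G(3) by blast
qed

text \<open>At each pair \<open>G\<close> itself selects the branch whose bounds still enclose it.
  Domination cannot end this path because \<open>G\<close> is a core, so its leaf is
  resolved.\<close>

lemma sandwich_search_sound:
  assumes G: "pair_graph G" "is_core G" "pverts G = {..<n}"
    and p: "\<And>x y. x < n \<Longrightarrow> y < n \<Longrightarrow> p x y \<Longrightarrow> (x, y) \<in> parcs G"
    and q: "\<And>x y. x < n \<Longrightarrow> y < n \<Longrightarrow> (x, y) \<in> parcs G \<Longrightarrow> q x y"
    and targets: "\<And>T. T \<in> set (Ts @ Hs) \<Longrightarrow> pair_graph T \<and> pverts T = {..<card (pverts T)}"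
    and us: "\<forall>(i, j)\<in>set us. i < n \<and> j < n \<and> i \<noteq> j"
    and search: "sandwich_search (map adj_matrix Ts) (map adj_matrix Hs) us
      (matrix p [0..<n]) (matrix q [0..<n])"
  shows "\<exists>T\<in>set (Ts @ Hs). (\<exists>f. graph_hom G T f) \<and> (\<exists>g. graph_hom T G g)"
  using p q us search
proof (induction us arbitrary: p q)
  case Nil
  then have "\<not> dominated (zip (matrix p [0..<n]) (matrix q [0..<n]))"
    by (intro sandwich_not_dominated[OF G]) auto
  with Nil have "resolved (map adj_matrix Ts) (map adj_matrix Hs) (matrix p [0..<n]) (matrix q [0..<n])"
    by simp
  from resolved_imp_hom_equivalent[OF G(1,3) Nil(1,2) targets this] show ?case by blast
next
  case (Cons u us)
  obtain i j where u: "u = (i, j)" "i < n" "j < n" "i \<noteq> j"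
    using Cons.prems(3) by (cases u) auto
  have "\<not> dominated (zip (matrix p [0..<n]) (matrix q [0..<n]))"
    using Cons.prems(1,2) by (intro sandwich_not_dominated[OF G]) auto
  with Cons.prems(4) u have searches:
    "sandwich_search (map adj_matrix Ts) (map adj_matrix Hs) us
      (set_entry i j True (matrix p [0..<n])) (matrix q [0..<n])"
    "sandwich_search (map adj_matrix Ts) (map adj_matrix Hs) us
      (matrix p [0..<n]) (set_entry i j False (matrix q [0..<n]))"
    by auto
  have us: "\<forall>(i, j)\<in>set us. i < n \<and> j < n \<and> i \<noteq> j"
    using Cons.prems(3) by simp
  have sym: "(j, i) \<in> parcs G \<longleftrightarrow> (i, j) \<in> parcs G"
    using pair_graph_sym[OF G(1)] by blast
  show ?case
  proof (cases "(i, j) \<in> parcs G")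
    case True
    show ?thesis
      by (rule Cons.IH[OF _ _ us searches(1)[unfolded set_entry_matrix[OF u(2-4)]]])
        (use True sym Cons.prems(1,2) in \<open>auto split: if_splits\<close>)
  next
    case False
    show ?thesis
      by (rule Cons.IH[OF _ _ us searches(2)[unfolded set_entry_matrix[OF u(2-4)]]])
        (use False sym Cons.prems(1,2) in \<open>auto split: if_splits\<close>)
  qed
qed

section \<open>The ten cores\<close>

definition nat_graph :: "nat \<Rightarrow> (nat \<Rightarrow> nat \<Rightarrow> bool) \<Rightarrow> nat pair_pre_digraph" where
  "nat_graph n A = \<lparr>pverts = {..<n}, parcs = {(i, j). i < n \<and> j < n \<and> A i j}\<rparr>"

lemma nat_graph_simps [simp]:
  "pverts (nat_graph n A) = {..<n}"
  "(i, j) \<in> parcs (nat_graph n A) \<longleftrightarrow> i < n \<and> j < n \<and> A i j"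
  by (auto simp: nat_graph_def)

lemma pair_graph_nat_graph:
  assumes "\<And>i j. i < n \<Longrightarrow> j < n \<Longrightarrow> A i j \<Longrightarrow> A j i" "\<And>i. \<not> A i i"
  shows "pair_graph (nat_graph n A)"
  using assms by (intro pair_graphI) (auto simp: sym_def)

lemma adj_matrix_nat_graph: "adj_matrix (nat_graph n A) = matrix A [0..<n]"
  by (simp add: adj_matrix_def matrix_def)

lemma graph_hom_nat_graph_imp_hom_exists:
  assumes "graph_hom (nat_graph m A) (nat_graph n B) f"
  shows "hom_exists (matrix A [0..<m]) (matrix B [0..<n])"
  using graph_hom_imp_hom_exists[OF assms, of "[0..<m]" "[0..<n]"]
    adj_matrix_nat_graph[of m A] adj_matrix_nat_graph[of n B]
  by (simp add: adj_matrix_def atLeast0LessThan)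

lemma row_degree_map: "row_degree (map P [0..<n]) = card {j. j < n \<and> P j}"
  by (auto simp: row_degree_def filter_map comp_def distinct_length_filter intro!: arg_cong[where f = card])

lemma card_parcs_nat_graph:
  "card (parcs (nat_graph n A)) = sum_list (map row_degree (matrix A [0..<n]))"
proof -
  have "parcs (nat_graph n A) = (SIGMA i:{..<n}. {j. j < n \<and> A i j})"
    by (auto simp: nat_graph_def)
  then show ?thesis
    by (simp add: matrix_def comp_def row_degree_map interv_sum_list_conv_sum_set_nat
        atLeast0LessThan)
qed

text \<open>Here \<open>matrix (\<noteq>) [0..<k]\<close> is the complete graph on \<open>k\<close>
  vertices, so the condition is an executable form of: not \<open>k\<close>-colourable, but
  \<open>k\<close>-colourable after deleting any vertex.\<close>

definition vertex_critical :: "nat \<Rightarrow> nat \<Rightarrow> (nat \<Rightarrow> nat \<Rightarrow> bool) \<Rightarrow> bool" where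
  "vertex_critical k n A \<longleftrightarrow> \<not> hom_exists (matrix A [0..<n]) (matrix (\<noteq>) [0..<k]) \<and>
     list_all (\<lambda>v. hom_exists (matrix A (filter ((\<noteq>) v) [0..<n])) (matrix (\<noteq>) [0..<k])) [0..<n]"

lemma is_core_vertex_critical:
  assumes G: "pair_graph (nat_graph n A)" and crit: "vertex_critical k n A"
  shows "is_core (nat_graph n A)"
proof (rule vertex_critical_is_core[where K = "nat_graph k (\<noteq>)"])
  have K: "pair_graph (nat_graph k (\<noteq>))"
    by (rule pair_graph_nat_graph) auto
  show "\<nexists>c. graph_hom (nat_graph n A) (nat_graph k (\<noteq>)) c"
  proof
    assume "\<exists>c. graph_hom (nat_graph n A) (nat_graph k (\<noteq>)) c"
    then obtain c where c: "graph_hom (nat_graph n A) (nat_graph k (\<noteq>)) c" by blast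
    have "hom_exists (matrix A [0..<n]) (matrix (\<noteq>) [0..<k])"
      using c by (rule graph_hom_nat_graph_imp_hom_exists)
    with crit show False by (simp add: vertex_critical_def)
  qed
  fix v assume v: "v \<in> pverts (nat_graph n A)"
  let ?vs = "filter ((\<noteq>) v) [0..<n]"
  \<comment> \<open>The subgraph obtained by deleting \<open>v\<close>.\<close>
  let ?H = "\<lparr>pverts = set ?vs, parcs = {(x, y) \<in> parcs (nat_graph n A). x \<noteq> v \<and> y \<noteq> v}\<rparr>"
  have "\<exists>c. graph_hom ?H (nat_graph k (\<noteq>)) c"
  proof (rule hom_exists_imp_graph_hom[where vs = ?vs and ws = "[0..<k]" and q = A and p = "(\<noteq>)"])
    show "pair_graph ?H"
      using pair_graph_sym[OF G] pair_graph_irrefl[OF G] by (intro pair_graphI) (auto simp: sym_def)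
    show "hom_exists (matrix A ?vs) (matrix (\<noteq>) [0..<k])"
      using crit v by (simp add: vertex_critical_def list_all_iff)
  qed (auto simp: K)
  then show "\<exists>c. (\<forall>x\<in>pverts (nat_graph n A) - {v}. c x \<in> pverts (nat_graph k (\<noteq>))) \<and>
      (\<forall>(x, y)\<in>parcs (nat_graph n A). x \<noteq> v \<longrightarrow> y \<noteq> v \<longrightarrow> (c x, c y) \<in> parcs (nat_graph k (\<noteq>)))"
    by (auto simp: graph_hom_def)
qed auto

section \<open>Executable adjacency predicates for the listed graphs\<close>

definition joined :: "(nat \<times> nat) list \<Rightarrow> nat \<Rightarrow> nat \<Rightarrow> bool" where
  "joined es i j \<longleftrightarrow> (i, j) \<in> set es \<or> (j, i) \<in> set es"

definition cyclic :: "nat \<Rightarrow> nat \<Rightarrow> nat \<Rightarrow> bool" where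
  "cyclic n i j \<longleftrightarrow> j = Suc i mod n \<or> i = Suc j mod n"

lemma complete_graph_nat_graph: "complete_graph n = nat_graph n (\<noteq>)"
  by (auto simp: complete_graph_def ugraph_def nat_graph_def)

lemma cycle_graph_nat_graph: "cycle_graph n = nat_graph n (cyclic n)"
  by (auto simp: cycle_graph_def ugraph_def nat_graph_def cyclic_def)

lemma complement_nat_graph: "complement_graph (nat_graph n A) = nat_graph n (\<lambda>i j. i \<noteq> j \<and> \<not> A i j)"
  by (auto simp: complement_graph_def nat_graph_def)

lemma C5_plus_2_nat_graph:
  "C5_plus_2 = nat_graph 7 (\<lambda>i j. if i < 5 \<and> j < 5 then cyclic 5 i j else i \<noteq> j)"
proof -
  have "i < 7 \<longleftrightarrow> i < 5 \<or> i = 5 \<or> i = 6" for i :: nat by auto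
  moreover have "cyclic 5 i j \<longleftrightarrow> cyclic 5 j i" for i j
    by (auto simp: cyclic_def)
  ultimately show ?thesis
    unfolding C5_plus_2_def ugraph_def cycle_graph_nat_graph
    by (auto simp: nat_graph_def split: if_splits)
qed

lemma ugraph_nat_graph:
  assumes "V = {..<n}" "E = set es" "\<forall>(i, j)\<in>set es. i < n \<and> j < n"
  shows "ugraph V E = nat_graph n (joined es)"
  using assms by (auto simp: ugraph_def nat_graph_def joined_def)

definition C5_list :: "(nat \<times> nat) list" where
  "C5_list = [(0, 1), (1, 2), (2, 3), (3, 4), (4, 0)]"

text \<open>K7 is left out: it is the complete case, which is treated apart from the search.\<close>

definition core_adjacencies :: "(nat \<Rightarrow> nat \<Rightarrow> bool) list" where
  "core_adjacencies = [
     cyclic 7, \<lambda>i j. i \<noteq> j \<and> \<not> cyclic 7 i j,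
     \<lambda>i j. if i < 5 \<and> j < 5 then cyclic 5 i j else i \<noteq> j,
     joined (C5_list @ [(5, 0), (5, 1), (5, 2), (6, 0), (6, 4), (6, 3)]),
     joined (C5_list @ [(5, 0), (5, 1), (5, 2), (6, 0), (6, 4), (6, 2), (6, 3)]),
     joined (C5_list @ [(5, 0), (5, 1), (5, 2), (5, 3), (6, 0), (6, 4), (6, 2), (6, 3)]),
     joined (C5_list @ [(5, 0), (5, 1), (5, 2), (6, 0), (6, 4), (6, 3), (5, 6)]),
     joined (C5_list @ [(5, 0), (5, 1), (5, 4), (5, 3), (6, 0), (6, 4), (6, 2)]),
     joined (C5_list @ [(5, 0), (5, 1), (5, 4), (5, 3), (6, 0), (6, 4), (6, 2), (6, 3)])]"

lemma core_list_eq: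
  "[complete_graph 7, cycle_graph 7, complement_graph (cycle_graph 7), C5_plus_2,
    core_G1, core_G2, core_G3, core_G4, core_G5, core_G6] =
   map (nat_graph 7) ((\<noteq>) # core_adjacencies)"
proof -
  have V: "{0, 1, 2, 3, 4, 5, 6} = {..<7::nat}" by auto
  have "core_G1 = nat_graph 7 (joined (C5_list @ [(5, 0), (5, 1), (5, 2), (6, 0), (6, 4), (6, 3)]))"
    "core_G2 = nat_graph 7 (joined (C5_list @ [(5, 0), (5, 1), (5, 2), (6, 0), (6, 4), (6, 2), (6, 3)]))"
    "core_G3 = nat_graph 7 (joined (C5_list @ [(5, 0), (5, 1), (5, 2), (5, 3), (6, 0), (6, 4), (6, 2), (6, 3)]))"
    "core_G4 = nat_graph 7 (joined (C5_list @ [(5, 0), (5, 1), (5, 2), (6, 0), (6, 4), (6, 3), (5, 6)]))"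
    "core_G5 = nat_graph 7 (joined (C5_list @ [(5, 0), (5, 1), (5, 4), (5, 3), (6, 0), (6, 4), (6, 2)]))"
    "core_G6 = nat_graph 7 (joined (C5_list @ [(5, 0), (5, 1), (5, 4), (5, 3), (6, 0), (6, 4), (6, 2), (6, 3)]))"
    unfolding core_G1_def core_G2_def core_G3_def core_G4_def core_G5_def core_G6_def
    by (intro ugraph_nat_graph V; simp add: C5_edges_def C5_list_def insert_commute)+
  then show ?thesis
    by (simp only: core_adjacencies_def complete_graph_nat_graph cycle_graph_nat_graph
        complement_nat_graph C5_plus_2_nat_graph list.map)
qed

lemma pair_graph_joined:
  "\<forall>(i, j)\<in>set es. i \<noteq> j \<Longrightarrow> pair_graph (nat_graph n (joined es))"
  by (rule pair_graph_nat_graph) (auto simp: joined_def)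

lemma cyclic_sym: "cyclic n i j \<Longrightarrow> cyclic n j i"
  by (auto simp: cyclic_def)

lemma cyclic_irrefl:
  assumes "n > 1"
  shows "\<not> cyclic n i i"
proof
  assume "cyclic n i i"
  then have eq: "Suc i mod n = i" by (auto simp: cyclic_def)
  moreover have "Suc i mod n < n" using assms by simp
  ultimately show False using assms by (cases "Suc i = n") auto
qed

lemma pair_graph_cyclic: "n > 1 \<Longrightarrow> pair_graph (nat_graph n (cyclic n))"
  by (rule pair_graph_nat_graph) (auto dest: cyclic_sym simp: cyclic_irrefl)

lemma pair_graph_core_adjacencies:
  assumes "A \<in> set ((\<noteq>) # core_adjacencies)"
  shows "pair_graph (nat_graph 7 A)"
proof -
  have "pair_graph (nat_graph 7 (\<noteq>))"
    "pair_graph (nat_graph 7 (\<lambda>i j. i \<noteq> j \<and> \<not> cyclic 7 i j))"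
    "pair_graph (nat_graph 7 (\<lambda>i j. if i < 5 \<and> j < 5 then cyclic 5 i j else i \<noteq> j))"
    by (rule pair_graph_nat_graph; auto dest: cyclic_sym simp: cyclic_irrefl split: if_splits)+
  then have "list_all (\<lambda>A. pair_graph (nat_graph 7 A)) ((\<noteq>) # core_adjacencies)"
    by (simp add: core_adjacencies_def pair_graph_joined pair_graph_cyclic C5_list_def)
  then show ?thesis
    using assms by (simp only: list_all_iff)
qed

text \<open>Each number is one below the chromatic number: 3 for C7, 4 for its complement, 5 for
  C5+2, and 4 for the six remaining graphs.\<close>

lemma vertex_critical_core_adjacencies:
  "list_all2 (\<lambda>k. vertex_critical k 7) [2, 3, 4, 3, 3, 3, 3, 3, 3] core_adjacencies"
  by code_simp

text \<open>Edge numbers separate all pairs except those among G2, G4, G5 and the pair G3, G6; there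
  a homomorphism from the earlier to the later graph is excluded.\<close>

lemma core_adjacencies_distinguished:
  "sorted_wrt (\<lambda>A B. sum_list (map row_degree (matrix A [0..<7])) \<noteq>
       sum_list (map row_degree (matrix B [0..<7])) \<or>
     \<not> hom_exists (matrix A [0..<7]) (matrix B [0..<7])) ((\<noteq>) # core_adjacencies)"
  by code_simp

lemma is_core_core_adjacencies:
  assumes "A \<in> set ((\<noteq>) # core_adjacencies)"
  shows "is_core (nat_graph 7 A)"
proof (cases "A = (\<noteq>)")
  case True
  then show ?thesis
    using pair_graph_core_adjacencies[OF assms] by (intro is_core_complete) auto
next
  case False
  then obtain k where "vertex_critical k 7 A"
    using assms list_all2_conv_all_nth[THEN iffD1, OF vertex_critical_core_adjacencies]
    by (auto simp: in_set_conv_nth)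
  then show ?thesis
    using pair_graph_core_adjacencies[OF assms] by (rule is_core_vertex_critical[rotated])
qed

lemma core_adjacencies_not_iso:
  assumes "i < 10" "j < 10" "i \<noteq> j"
  shows "\<not> digraph_iso (with_proj (map (nat_graph 7) ((\<noteq>) # core_adjacencies) ! i))
    (with_proj (map (nat_graph 7) ((\<noteq>) # core_adjacencies) ! j))"
proof -
  define L where "L = (\<noteq>) # core_adjacencies"
  have len: "length L = 10" by (simp add: L_def core_adjacencies_def)
  \<comment> \<open>The computed test covers only \<open>i < j\<close>; an isomorphism yields
    homomorphisms both ways, so either order of the indices reduces to it.\<close>
  have less: False if "i < j" "j < 10" "(\<exists>f. graph_hom (nat_graph 7 (L ! i)) (nat_graph 7 (L ! j)) f)"
    "card (parcs (nat_graph 7 (L ! i))) = card (parcs (nat_graph 7 (L ! j)))" for i j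
  proof -
    have "hom_exists (matrix (L ! i) [0..<7]) (matrix (L ! j) [0..<7])"
      using that(3) graph_hom_nat_graph_imp_hom_exists by blast
    with that(4) sorted_wrt_nth_less[OF core_adjacencies_distinguished[folded L_def] that(1)] that(2)
    show False
      by (simp add: len card_parcs_nat_graph)
  qed
  show ?thesis
  proof
    assume "digraph_iso (with_proj (map (nat_graph 7) ((\<noteq>) # core_adjacencies) ! i))
      (with_proj (map (nat_graph 7) ((\<noteq>) # core_adjacencies) ! j))"
    then have "digraph_iso (with_proj (nat_graph 7 (L ! i))) (with_proj (nat_graph 7 (L ! j)))"
      using assms len unfolding L_def[symmetric] by simp
    note homs = digraph_iso_imp_homs[OF this]
    from assms(3) consider "i < j" | "j < i" by linarith
    then show False
    proof cases
      case 1
      then show ?thesis using less[of i j] homs(1,3) assms(2) by blast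
    next
      case 2
      then show ?thesis using less[of j i] homs(2) homs(3)[symmetric] assms(1) by blast
    qed
  qed
qed

section \<open>Every core on seven vertices is in the list\<close>

text \<open>Positions 0 to 4 carry the induced 5-cycle, with its chords as non-edges; the eleven
  pairs meeting 5 or 6 are undecided.\<close>

lemma C5_search:
  "sandwich_search [matrix (\<noteq>) [0..<3], matrix (\<noteq>) [0..<4], matrix (cyclic 5) [0..<5]]
     (map (\<lambda>A. matrix A [0..<7]) core_adjacencies)
     [(5, 6), (4, 6), (3, 6), (2, 6), (1, 6), (0, 6), (4, 5), (3, 5), (2, 5), (1, 5), (0, 5)]
     (matrix (joined [(0, 1), (1, 2), (2, 3), (3, 4), (4, 0)]) [0..<7])
     (matrix (\<lambda>i j. i \<noteq> j \<and> \<not> joined [(0, 2), (0, 3), (1, 3), (1, 4), (2, 4)] i j) [0..<7])"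
  by code_simp

text \<open>Positions 0 to 3 carry the induced path, 4 and 5 are the extra neighbours of its ends 0
  and 3, and nothing is known about 6.\<close>

lemma P4_search:
  "sandwich_search [matrix (\<noteq>) [0..<3], matrix (\<noteq>) [0..<4], matrix (cyclic 5) [0..<5]]
     (map (\<lambda>A. matrix A [0..<7]) core_adjacencies)
     [(5, 6), (4, 6), (3, 6), (2, 6), (1, 6), (0, 6), (4, 5), (2, 5), (0, 5), (3, 4), (1, 4)]
     (matrix (joined [(0, 1), (1, 2), (2, 3), (0, 4), (3, 5)]) [0..<7])
     (matrix (\<lambda>i j. i \<noteq> j \<and> \<not> joined [(0, 2), (0, 3), (1, 3), (2, 4), (1, 5)] i j) [0..<7])"
  by code_simp

section \<open>Transfer of an arbitrary core to natural-number vertices\<close>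

lemma is_core_relabel:
  assumes core: "is_core G" and g: "graph_hom H G g" and g': "graph_hom G H g'"
    and inv: "\<And>x. x \<in> pverts H \<Longrightarrow> g' (g x) = x" and fin: "finite (pverts H)"
  shows "is_core H"
  unfolding is_core_def
proof (intro allI impI)
  fix f assume f: "graph_hom H H f"
  \<comment> \<open>Conjugating \<open>f\<close> gives an endomorphism of the core \<open>G\<close>;
    its injectivity passes back to \<open>f\<close>.\<close>
  have "graph_hom G G (g \<circ> (f \<circ> g'))"
    using graph_hom_comp[OF graph_hom_comp[OF g' f] g] .
  then have inj: "inj_on (g \<circ> (f \<circ> g')) (pverts G)"
    using core_endo_bij[OF core] by (auto simp: bij_betw_def)
  have "inj_on f (pverts H)"
  proof (rule inj_onI)
    fix x y assume xy: "x \<in> pverts H" "y \<in> pverts H" "f x = f y"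
    then have "g x \<in> pverts G" "g y \<in> pverts G"
      using g by (auto simp: graph_hom_def)
    moreover have "(g \<circ> (f \<circ> g')) (g x) = (g \<circ> (f \<circ> g')) (g y)"
      by (simp add: inv xy)
    ultimately have "g x = g y"
      using inj_onD[OF inj] by blast
    with inv xy show "x = y" by metis
  qed
  then show "bij_betw f (pverts H) (pverts H)"
    using f fin by (simp add: bij_betw_def graph_hom_def endo_inj_surj image_subset_iff)
qed

lemma relabel_core:
  assumes G: "pair_graph G" "is_core G" and vs: "distinct vs" "set vs = pverts G"
  defines "H \<equiv> nat_graph (length vs) (\<lambda>i j. (vs ! i, vs ! j) \<in> parcs G)"
  shows "pair_graph H" "is_core H" "\<exists>f. graph_hom G H f" "\<exists>g. graph_hom H G g"
proof -
  define g' where "g' = the_inv_into {..<length vs} (nth vs)"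
  have bij: "bij_betw (nth vs) {..<length vs} (pverts G)"
    using bij_betw_nth[OF vs(1) refl vs(2)[symmetric]] .
  have inv: "g' (vs ! i) = i" if "i < length vs" for i
    using bij that unfolding g'_def bij_betw_def by (intro the_inv_into_f_f) auto
  have inv': "g' x < length vs" "vs ! g' x = x" if "x \<in> pverts G" for x
  proof -
    obtain i where "i < length vs" "x = vs ! i"
      using \<open>x \<in> pverts G\<close> unfolding vs(2)[symmetric] in_set_conv_nth by blast
    then show "g' x < length vs" "vs ! g' x = x"
      by (simp_all add: inv)
  qed
  show "pair_graph H"
    unfolding H_def
    by (rule pair_graph_nat_graph) (use pair_graph_sym[OF G(1)] pair_graph_irrefl[OF G(1)] in blast)+
  have g: "graph_hom H G (nth vs)"
    unfolding graph_hom_def H_def vs(2)[symmetric] by auto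
  have g': "graph_hom G H g'"
    unfolding graph_hom_def H_def using inv' pair_graph_arcD[OF G(1)] by auto
  show "is_core H"
    using G(2) g g' by (rule is_core_relabel) (auto simp: H_def inv)
  show "\<exists>f. graph_hom G H f" "\<exists>g. graph_hom H G g"
    using g g' by blast+
qed

lemma hom_equivalent_to_core_adjacency:
  assumes G: "pair_graph G" "is_core G" and A: "A \<in> set ((\<noteq>) # core_adjacencies)"
    and "\<exists>f. graph_hom G (nat_graph 7 A) f" "\<exists>g. graph_hom (nat_graph 7 A) G g"
  shows "digraph_iso (with_proj G) (with_proj (nat_graph 7 A))"
  using hom_equivalent_cores_iso[OF G pair_graph_core_adjacencies[OF A] is_core_core_adjacencies[OF A]]
    assms(4,5) by blast

text \<open>The search makes \<open>G\<close> homomorphically equivalent to a target. A core embeds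
  injectively into any graph equivalent to it, which excludes the targets with fewer than seven
  vertices.\<close>

lemma core_from_search:
  assumes G: "pair_graph G" "is_core G" and vs: "distinct vs" "set vs = pverts G" "length vs = 7"
    and edges: "\<forall>(i, j)\<in>set es. (vs ! i, vs ! j) \<in> parcs G"
    and non_edges: "\<forall>(i, j)\<in>set ns. (vs ! i, vs ! j) \<notin> parcs G"
    and us: "\<forall>(i, j)\<in>set us. i < 7 \<and> j < 7 \<and> i \<noteq> j"
    and search: "sandwich_search [matrix (\<noteq>) [0..<3], matrix (\<noteq>) [0..<4], matrix (cyclic 5) [0..<5]]
      (map (\<lambda>A. matrix A [0..<7]) core_adjacencies) us
      (matrix (joined es) [0..<7]) (matrix (\<lambda>i j. i \<noteq> j \<and> \<not> joined ns i j) [0..<7])"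
  shows "\<exists>A\<in>set core_adjacencies. digraph_iso (with_proj G) (with_proj (nat_graph 7 A))"
proof -
  define H where "H = nat_graph 7 (\<lambda>i j. (vs ! i, vs ! j) \<in> parcs G)"
  have H: "pair_graph H" "is_core H" and GH: "\<exists>f. graph_hom G H f" "\<exists>g. graph_hom H G g"
    using relabel_core[OF G vs(1,2)] unfolding H_def vs(3) by blast+
  let ?Ts = "[nat_graph 3 (\<noteq>), nat_graph 4 (\<noteq>), nat_graph 5 (cyclic 5)]"
  let ?Hs = "map (nat_graph 7) core_adjacencies"
  have small: "pair_graph T \<and> pverts T = {..<card (pverts T)} \<and> card (pverts T) < 7" if "T \<in> set ?Ts" for T
    using that pair_graph_cyclic[of 5] by (auto intro!: pair_graph_nat_graph)
  have "\<exists>T\<in>set (?Ts @ ?Hs). (\<exists>f. graph_hom H T f) \<and> (\<exists>g. graph_hom T H g)"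
  proof (rule sandwich_search_sound[OF H, where n = 7 and us = us and p = "joined es" and
        q = "\<lambda>i j. i \<noteq> j \<and> \<not> joined ns i j"])
    show "sandwich_search (map adj_matrix ?Ts) (map adj_matrix ?Hs) us
      (matrix (joined es) [0..<7]) (matrix (\<lambda>i j. i \<noteq> j \<and> \<not> joined ns i j) [0..<7])"
      using search by (simp add: adj_matrix_nat_graph comp_def)
    show "pair_graph T \<and> pverts T = {..<card (pverts T)}" if "T \<in> set (?Ts @ ?Hs)" for T
      using that small pair_graph_core_adjacencies by auto
    show "(x, y) \<in> parcs H" if "x < 7" "y < 7" "joined es x y" for x y
      using that edges pair_graph_sym[OF G(1)] by (auto simp: H_def joined_def)
    show "x \<noteq> y \<and> \<not> joined ns x y" if "(x, y) \<in> parcs H" for x y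
      using that non_edges pair_graph_sym[OF G(1)] pair_graph_irrefl[OF G(1)]
      by (auto simp: H_def joined_def)
  qed (use us in \<open>auto simp: H_def\<close>)
  then obtain T where T: "T \<in> set (?Ts @ ?Hs)"
    and "\<exists>f. graph_hom H T f" "\<exists>g. graph_hom T H g"
    by blast
  then have homs: "\<exists>f. graph_hom G T f" "\<exists>g. graph_hom T G g"
    using GH graph_hom_comp by blast+
  have "card (pverts G) = 7"
    using vs distinct_card by metis
  then have "T \<notin> set ?Ts"
    using homs small[of T] core_hom_card_le[OF G(2)]
    by (metis finite_lessThan not_less)
  with T homs show ?thesis
    using hom_equivalent_to_core_adjacency[OF G] by auto
qed

text \<open>Puts the named vertices first, so that their positions match the matrices of the
  searches.\<close>

lemma ex_enumeration:
  assumes "finite V" "distinct us" "set us \<subseteq> V"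
  shows "\<exists>ws. distinct (us @ ws) \<and> set (us @ ws) = V \<and> length (us @ ws) = card V"
proof -
  obtain ws where ws: "set ws = V - set us" "distinct ws"
    using assms(1) finite_distinct_list[of "V - set us"] by auto
  then have "distinct (us @ ws)" "set (us @ ws) = V"
    using assms by auto
  then show ?thesis using distinct_card by metis
qed

lemma core_on_7_vertices:
  assumes G: "pair_graph G" "is_core G" and card: "card (pverts G) = 7"
  shows "\<exists>A\<in>set ((\<noteq>) # core_adjacencies). digraph_iso (with_proj G) (with_proj (nat_graph 7 A))"
proof (cases "\<exists>x\<in>pverts G. \<exists>y\<in>pverts G. x \<noteq> y \<and> (x, y) \<notin> parcs G")
  case False
  obtain vs where vs: "distinct vs" "set vs = pverts G" "length vs = 7"
    using ex_enumeration[of "pverts G" "[]"] pair_graph_finite[OF G(1)] card by auto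
  have "(vs ! i, vs ! j) \<in> parcs G \<longleftrightarrow> i \<noteq> j" if "i < 7" "j < 7" for i j
    using False that vs pair_graph_irrefl[OF G(1)] by (metis nth_eq_iff_index_eq nth_mem)
  then have "nat_graph 7 (\<lambda>i j. (vs ! i, vs ! j) \<in> parcs G) = nat_graph 7 (\<noteq>)"
    by (auto simp: nat_graph_def)
  with relabel_core(3,4)[OF G vs(1,2)] vs(3) show ?thesis
    using hom_equivalent_to_core_adjacency[OF G, of "(\<noteq>)"] by auto
next
  case True
  note sym = pair_graph_sym[OF G(1)] and irrefl = pair_graph_irrefl[OF G(1)]
    and arcD = pair_graph_arcD[OF G(1)] and fin = pair_graph_finite[OF G(1)]
  obtain a b c d where P4: "(a, b) \<in> parcs G" "(b, c) \<in> parcs G" "(c, d) \<in> parcs G"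
    "(a, c) \<notin> parcs G" "(b, d) \<notin> parcs G" "(a, d) \<notin> parcs G"
    using core_induced_P4[OF G True] by blast
  \<comment> \<open>Identifying any two of the four vertices would create a loop or turn one of the
    three non-edges into an edge.\<close>
  have neq: "a \<noteq> b" "a \<noteq> c" "a \<noteq> d" "b \<noteq> c" "b \<noteq> d" "c \<noteq> d"
    using P4 sym irrefl by metis+
  have verts: "{a, b, c, d} \<subseteq> pverts G"
    using P4 arcD by blast
  \<comment> \<open>\<open>a\<close> is not dominated by \<open>c\<close>, and \<open>d\<close> is
    not dominated by \<open>b\<close>; the witnesses lie off the path since \<open>b\<close> is
    adjacent to \<open>c\<close>, and \<open>a\<close>, \<open>d\<close> have no further neighbours
    on it.\<close>
  obtain z where z: "(a, z) \<in> parcs G" "(c, z) \<notin> parcs G"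
    using core_not_dominated[OF G, of a c] verts neq by auto
  obtain w where w: "(d, w) \<in> parcs G" "(b, w) \<notin> parcs G"
    using core_not_dominated[OF G, of d b] verts neq by auto
  have neq_z: "z \<noteq> a" "z \<noteq> b" "z \<noteq> c" "z \<noteq> d" and neq_w: "w \<noteq> a" "w \<noteq> b" "w \<noteq> c" "w \<noteq> d"
    using P4 z w sym irrefl by metis+
  have "\<exists>A\<in>set core_adjacencies. digraph_iso (with_proj G) (with_proj (nat_graph 7 A))"
  proof (cases "z = w")
    case True
    \<comment> \<open>The common vertex is adjacent to \<open>a\<close> and \<open>d\<close> but not
      to \<open>b\<close> or \<open>c\<close>, so it closes the path to an induced 5-cycle.\<close>
    obtain ws where ws: "distinct ([a, b, c, d, z] @ ws)" "set ([a, b, c, d, z] @ ws) = pverts G"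
      "length ([a, b, c, d, z] @ ws) = 7"
      using ex_enumeration[of "pverts G" "[a, b, c, d, z]"] fin card verts neq neq_z arcD(2)[OF z(1)]
      by auto
    show ?thesis
      by (rule core_from_search[OF G ws _ _ _ C5_search])
        (use P4 z w True sym in auto)
  next
    case False
    \<comment> \<open>The remaining five adjacencies of \<open>z\<close> and \<open>w\<close> among
      these six vertices are left to the search.\<close>
    obtain ws where ws: "distinct ([a, b, c, d, z, w] @ ws)" "set ([a, b, c, d, z, w] @ ws) = pverts G"
      "length ([a, b, c, d, z, w] @ ws) = 7"
      using ex_enumeration[of "pverts G" "[a, b, c, d, z, w]"] fin card verts neq neq_z neq_w False
        arcD(2)[OF z(1)] arcD(2)[OF w(1)]
      by auto
    show ?thesis
      by (rule core_from_search[OF G ws _ _ _ P4_search])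
        (use P4 z w sym in auto)
  qed
  then show ?thesis by auto
qed

theorem theorem5p8:
  "let L = [complete_graph 7, cycle_graph 7, complement_graph (cycle_graph 7), C5_plus_2,
            core_G1, core_G2, core_G3, core_G4, core_G5, core_G6]
   in length L = 10 \<and>
      (\<forall>H\<in>set L. pair_graph H \<and> card (pverts H) = 7 \<and> is_core H) \<and>
      (\<forall>i<length L. \<forall>j<length L. i \<noteq> j \<longrightarrow>
         \<not> digraph_iso (with_proj (L ! i)) (with_proj (L ! j))) \<and>
      (\<forall>G :: 'a pair_pre_digraph. pair_graph G \<and> card (pverts G) = 7 \<and> is_core G \<longrightarrow>
         (\<exists>H\<in>set L. digraph_iso (with_proj G) (with_proj H)))"
proof -
  define L where "L = map (nat_graph 7) ((\<noteq>) # core_adjacencies)"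
  have "length L = 10" by (simp add: L_def core_adjacencies_def)
  moreover have "\<forall>H\<in>set L. pair_graph H \<and> card (pverts H) = 7 \<and> is_core H"
    unfolding L_def set_map
    using pair_graph_core_adjacencies is_core_core_adjacencies by (metis card_lessThan imageE nat_graph_simps(1))
  moreover have "\<forall>i<10. \<forall>j<10. i \<noteq> j \<longrightarrow> \<not> digraph_iso (with_proj (L ! i)) (with_proj (L ! j))"
    unfolding L_def using core_adjacencies_not_iso by blast
  moreover have "\<exists>H\<in>set L. digraph_iso (with_proj G) (with_proj H)"
    if "pair_graph G" "card (pverts G) = 7" "is_core G" for G :: "'a pair_pre_digraph"
    using core_on_7_vertices[OF that(1,3,2)] by (auto simp: L_def)
  ultimately show ?thesis
    unfolding core_list_eq L_def[symmetric] Let_def by simp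
qed

end
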